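(* Let $G$ be a graph with vertices $v_1,\dots,v_n$ satisfying $Z(G)=M(G)$ and $\mathrm{mr}(G)=\mathrm{cc}(G)$, and let $H_1,\dots,H_n$ be graphs satisfying $Z(H_i)=M(H_i)$ and $\mathrm{mr}(H_i)=\mathrm{cc}(H_i)$ for $i=1,\dots,n$. Then \[ Z(G\prec H_1,\dots,H_n\succ)=M(G\prec H_1,\dots,H_n\succ) \quad\text{and}\quad \mathrm{mr}(G\prec H_1,\dots,H_n\succ)=\mathrm{cc}(G\prec H_1,\dots,H_n\succ). \]
   Context: All graphs are finite, simple and undirected. For a graph $G$ on vertex set $\{1,\dots,n\}$, $\mathcal S(G)$ is the set of real symmetric $n\times n$ matrices $A=[a_{ij}]$ such that for $i\ne j$, $a_{ij}\ne 0$ if and only if $ij\in E(G)$ (diagonal entries are unrestricted). The minimum rank is $\mathrm{mr}(G)=\min\{\mathrm{rank}A: A\in\mathcal S(G)\}$ and the maximum nullity is $M(G)=\max\{\mathrm{nullity}A: A\in\mathcal S(G)\}$. The clique cover number $\mathrm{cc}(G)$ is the minimum number of cliques of $G$ such that every edge of $G$ lies in at least one of them. Zero forcing: vertices are coloured black or white; if a black vertex $u$ has exactly one white neighbour $v$, then $v$ is recoloured black; $Z(G)$ is the minimum size of a set of initially black vertices from which repeated application of this rule colours all vertices black. The generalized corona $G\prec H_1,\dots,H_n\succ$ is obtained from the disjoint union of $G,H_1,\dots,H_n$ by joining every vertex of $H_i$ to the $i$-th vertex $v_i$ of $G$, for $i=1,\dots,n$.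
   Formalization: The formal theorem additionally assumes that no H_i has an isolated vertex; without this the claim fails, e.g. G=K_1 and H_1=3K_1 give the star K_{1,3} with mr=2 but cc=3. *)

theory Defs
  imports
    "Graph_Theory.Pair_Digraph"
    "Jordan_Normal_Form.DL_Rank"
    "Jordan_Normal_Form.Matrix_Kernel"
begin

text \<open>
  A finite simple undirected graph is a \<open>pair_graph\<close> from the Graph\_Theory library: a finite
  set of vertices with a symmetric, irreflexive set of ordered pairs, so that an undirected edge
  \<open>uv\<close> is represented by the two pairs \<open>(u, v)\<close> and \<open>(v, u)\<close>.
\<close>

subsection \<open>Minimum rank and maximum nullity\<close>

text \<open>
  Vertices may be of any type, so a matrix gets its indices from an enumeration \<open>vs\<close> of the
  vertices. \<open>matrices_of G\<close> collects the matrices for all enumerations: it is the set of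
  matrices described by \<open>G\<close>, closed under simultaneous permutation of rows and columns, which
  changes neither rank nor nullity.
\<close>

definition describes :: "'a pair_pre_digraph \<Rightarrow> 'a list \<Rightarrow> real mat \<Rightarrow> bool" where
  "describes G vs A \<longleftrightarrow>
     A \<in> carrier_mat (length vs) (length vs) \<and> A\<^sup>T = A \<and>
     (\<forall>i<length vs. \<forall>j<length vs. i \<noteq> j \<longrightarrow>
        (A $$ (i, j) \<noteq> 0 \<longleftrightarrow> (vs ! i, vs ! j) \<in> parcs G))"

definition matrices_of :: "'a pair_pre_digraph \<Rightarrow> real mat set" where
  "matrices_of G = {A. \<exists>vs. distinct vs \<and> set vs = pverts G \<and> describes G vs A}"

definition mat_rank :: "real mat \<Rightarrow> nat" where
  "mat_rank A = vec_space.rank (dim_row A) A"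

definition min_rank :: "'a pair_pre_digraph \<Rightarrow> nat" where
  "min_rank G = Min (mat_rank ` matrices_of G)"

definition max_nullity :: "'a pair_pre_digraph \<Rightarrow> nat" where
  "max_nullity G = Max (kernel_dim ` matrices_of G)"

subsection \<open>Clique cover number\<close>

definition clique :: "'a pair_pre_digraph \<Rightarrow> 'a set \<Rightarrow> bool" where
  "clique G C \<longleftrightarrow> C \<subseteq> pverts G \<and> (\<forall>u\<in>C. \<forall>v\<in>C. u \<noteq> v \<longrightarrow> (u, v) \<in> parcs G)"

text \<open>
  Only edges have to be covered, so isolated vertices do not contribute to the clique cover number.
\<close>

definition clique_cover :: "'a pair_pre_digraph \<Rightarrow> 'a set set \<Rightarrow> bool" where
  "clique_cover G \<C> \<longleftrightarrow>
     (\<forall>C\<in>\<C>. clique G C) \<and> (\<forall>(u, v)\<in>parcs G. \<exists>C\<in>\<C>. u \<in> C \<and> v \<in> C)"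

definition clique_cover_number :: "'a pair_pre_digraph \<Rightarrow> nat" where
  "clique_cover_number G = Min (card ` {\<C>. clique_cover G \<C>})"

subsection \<open>Zero forcing number\<close>

text \<open>The set of black vertices changes from \<open>B\<close> to \<open>B'\<close> by one application of the rule.\<close>

definition colour_change :: "'a pair_pre_digraph \<Rightarrow> 'a set \<Rightarrow> 'a set \<Rightarrow> bool" where
  "colour_change G B B' \<longleftrightarrow>
     (\<exists>u\<in>B. \<exists>v. {w. (u, w) \<in> parcs G \<and> w \<notin> B} = {v} \<and> B' = insert v B)"

definition zero_forcing_set :: "'a pair_pre_digraph \<Rightarrow> 'a set \<Rightarrow> bool" where
  "zero_forcing_set G B \<longleftrightarrow> B \<subseteq> pverts G \<and> (colour_change G)\<^sup>*\<^sup>* B (pverts G)"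

definition zero_forcing_number :: "'a pair_pre_digraph \<Rightarrow> nat" where
  "zero_forcing_number G = Min (card ` {B. zero_forcing_set G B})"

subsection \<open>Generalized corona\<close>

text \<open>
  The family \<open>H\<close> is indexed by the vertices of \<open>G\<close>. In the disjoint union, a vertex \<open>v\<close> of \<open>G\<close>
  becomes \<open>Inl v\<close> and a vertex \<open>x\<close> of \<open>H v\<close> becomes \<open>Inr (v, x)\<close>.
\<close>

definition gen_corona ::
  "'a pair_pre_digraph \<Rightarrow> ('a \<Rightarrow> 'b pair_pre_digraph) \<Rightarrow> ('a + 'a \<times> 'b) pair_pre_digraph" where
  "gen_corona G H = \<lparr>
     pverts = Inl ` pverts G \<union> {Inr (v, x) |v x. v \<in> pverts G \<and> x \<in> pverts (H v)},
     parcs = {(Inl u, Inl v) |u v. (u, v) \<in> parcs G}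
       \<union> {(Inr (v, x), Inr (v, y)) |v x y. v \<in> pverts G \<and> (x, y) \<in> parcs (H v)}
       \<union> {(Inl v, Inr (v, x)) |v x. v \<in> pverts G \<and> x \<in> pverts (H v)}
       \<union> {(Inr (v, x), Inl v) |v x. v \<in> pverts G \<and> x \<in> pverts (H v)}\<rparr>"

lemma pair_graph_gen_corona:
  assumes G: "pair_graph G" and H: "\<And>v. v \<in> pverts G \<Longrightarrow> pair_graph (H v)"
  shows "pair_graph (gen_corona G H)"
proof -
  interpret G: pair_graph G by (rule G)
  let ?K = "gen_corona G H"
  have Hin: "x \<in> pverts (H v) \<and> y \<in> pverts (H v) \<and> x \<noteq> y \<and> (y, x) \<in> parcs (H v)"
    if v: "v \<in> pverts G" and xy: "(x, y) \<in> parcs (H v)" for v x y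
  proof -
    interpret Hv: pair_graph "H v" by (rule H[OF v])
    show ?thesis
      using Hv.arc_fst_in_verts[OF xy] Hv.arc_snd_in_verts[OF xy] Hv.pair_no_loops[OF xy]
        Hv.arcs_symmetric[OF xy] by simp
  qed
  have Gin: "x \<in> pverts G \<and> y \<in> pverts G \<and> x \<noteq> y \<and> (y, x) \<in> parcs G"
    if "(x, y) \<in> parcs G" for x y
    using G.arc_fst_in_verts[OF that] G.arc_snd_in_verts[OF that] G.pair_no_loops[OF that]
      G.arcs_symmetric[OF that] by simp
  have fin: "finite (pverts (H v))" if "v \<in> pverts G" for v
    using pair_fin_digraph.pair_finite_verts[of "H v"] H[OF that]
    by (simp add: pair_graph_def pair_digraph_def)
  have "pverts ?K = Inl ` pverts G \<union> Inr ` (SIGMA v:pverts G. pverts (H v))"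
    by (auto simp: gen_corona_def)
  then have finK: "finite (pverts ?K)"
    using fin G.pair_finite_verts by simp
  have sub: "parcs ?K \<subseteq> pverts ?K \<times> pverts ?K"
    using Hin Gin by (auto simp: gen_corona_def)
  have loop: "fst e \<noteq> snd e" if "e \<in> parcs ?K" for e
    using that Hin Gin by (auto simp: gen_corona_def)
  have sym: "sym (parcs ?K)"
  proof (rule symI)
    fix a b assume "(a, b) \<in> parcs ?K"
    then consider
        u v where "(a, b) = (Inl u, Inl v)" "(u, v) \<in> parcs G"
      | v x y where "(a, b) = (Inr (v, x), Inr (v, y))" "v \<in> pverts G" "(x, y) \<in> parcs (H v)"
      | v x where "(a, b) = (Inl v, Inr (v, x))" "v \<in> pverts G" "x \<in> pverts (H v)"
      | v x where "(a, b) = (Inr (v, x), Inl v)" "v \<in> pverts G" "x \<in> pverts (H v)"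
      by (auto simp: gen_corona_def)
    then show "(b, a) \<in> parcs ?K"
    proof cases
      case (1 u v)
      with Gin[OF 1(2)] show ?thesis by (simp add: gen_corona_def)
    next
      case (2 v x y)
      with Hin[OF 2(2,3)] show ?thesis by (simp add: gen_corona_def)
    qed (simp_all add: gen_corona_def)
  qed
  show ?thesis
  proof unfold_locales
    show "symmetric (with_proj ?K)" using sym by (simp add: symmetric_def)
  qed (use sub loop finK finite_subset[OF sub] in auto)
qed

end

theory Submission
  imports Defs
begin

text \<open>
  For every graph, \<open>M \<le> Z\<close> (a null vector vanishing on a zero forcing set vanishes everywhere),
  \<open>mr \<le> cc\<close> (add up the rank-one 0/1 matrices of the cliques of a cover) and \<open>mr + M = n\<close>.
  In the corona, zero forcing sets of \<open>G\<close> and of all \<open>H v\<close> together form a zero forcing set: once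
  \<open>v\<close> is black, it does not obstruct the forces inside \<open>H v\<close>, and once \<open>H v\<close> is black, \<open>v\<close> can force
  as it does in \<open>G\<close>. Adding \<open>v\<close> to each clique of a cover of \<open>H v\<close> also covers the edges between \<open>v\<close>
  and \<open>H v\<close>, as \<open>H v\<close> has no isolated vertices. So \<open>Z\<close> and \<open>cc\<close> of the corona are at most the sums
  of those of the parts, and by the hypotheses these sums add up to the number of vertices of the
  corona, which is its \<open>mr + M\<close>. Hence \<open>M \<le> Z\<close> and \<open>mr \<le> cc\<close> are equalities for the corona.
\<close>

section \<open>Rank and nullity of real matrices\<close>

lemma rank_plus_kernel_dim:
  fixes A :: "real mat"
  shows "mat_rank A + kernel_dim A = dim_col A"
proof -
  define nr nc where "nr = dim_row A" and "nc = dim_col A"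
  have A: "A \<in> carrier_mat nr nc"
    by (simp add: nr_def nc_def)
  interpret W: vec_space "TYPE(real)" nr .
  interpret kernel nr nc A
    by unfold_locales (rule A)
  \<comment> \<open>Rank-nullity is applied to the map \<open>v\<close> to \<open>A v\<close>
    between coordinate spaces: its kernel is \<open>mat_kernel A\<close> and its image is the column
    span whose dimension defines \<open>rank\<close>.\<close>
  have hom: "(\<lambda>v. A *\<^sub>v v) \<in> module_hom class_ring NC.V W.V"
    using A mult_add_distrib_mat_vec[OF A] mult_mat_vec[OF A]
    by (auto simp: module_hom_def module_vec_simps)
  interpret T: linear_map class_ring NC.V W.V "\<lambda>v. A *\<^sub>v v"
    by (intro linear_map.intro mod_hom.intro mod_hom_axioms.intro NC.vectorspace_axioms
        W.vectorspace_axioms NC.module_axioms W.module_axioms hom)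
  have "T.kerT = mat_kernel A"
    unfolding T.ker_def mat_kernel[OF A] by (simp add: module_vec_simps)
  moreover have "T.imT = W.span (set (cols A))"
    unfolding T.im_def W.col_space_def[symmetric] W.col_space_eq[OF A]
    using A by (auto simp: module_vec_simps)
  moreover note T.rank_nullity[OF NC.fin_dim]
  ultimately show ?thesis
    unfolding mat_rank_def kernel_dim NC.dim_is_n
    using A by (simp add: W.rank_def)
qed

lemma mat_rank_add_le:
  assumes "A \<in> carrier_mat n nc" and "B \<in> carrier_mat n nc"
  shows "mat_rank (A + B) \<le> mat_rank A + mat_rank B"
  using vec_space.rank_subadditive[OF assms] assms by (simp add: mat_rank_def)

text \<open>Every \<open>(A * B) v\<close> equals \<open>A (B v)\<close>, so the column space of
  \<open>A * B\<close> is a subspace of that of \<open>A\<close>.\<close>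

lemma mat_rank_mult_le:
  assumes A: "A \<in> carrier_mat n m" and B: "B \<in> carrier_mat m k"
  shows "mat_rank (A * B) \<le> mat_rank A"
proof -
  interpret vec_space "TYPE(real)" n .
  have AB: "A * B \<in> carrier_mat n k"
    using A B by simp
  let ?S = "\<lambda>M :: real mat. span (set (cols M))"
  have car: "set (cols M) \<subseteq> carrier_vec n" if "M \<in> carrier_mat n l" for M :: "real mat" and l
    using that cols_dim by blast
  have sub: "subspace class_ring (?S M) V" if "M \<in> carrier_mat n l" for M :: "real mat" and l
    using span_is_subspace car[OF that] by simp
  have "?S (A * B) \<subseteq> ?S A"
  proof
    fix y assume "y \<in> ?S (A * B)"
    then obtain x where "x \<in> carrier_vec k" and "y = (A * B) *\<^sub>v x"
      unfolding col_space_def[symmetric] col_space_eq[OF AB] using B by auto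
    then have "B *\<^sub>v x \<in> carrier_vec m" and "y = A *\<^sub>v (B *\<^sub>v x)"
      using A B by auto
    then show "y \<in> ?S A"
      unfolding col_space_def[symmetric] col_space_eq[OF A] using A by auto
  qed
  then have "subspace class_ring (?S (A * B)) (vs (?S A))"
    using nested_subspaces sub A AB by blast
  then have "rank (A * B) \<le> rank A"
    unfolding rank_def
    using vectorspace.subspace_dim[OF subspace_is_vs[OF sub[OF A]]]
      fin_dim_span_cols[OF A] fin_dim_span_cols[OF AB] by simp
  then show ?thesis
    using A by (simp add: mat_rank_def)
qed

text \<open>The sum of the rank-one matrices formed as the outer product of each \<open>f C\<close>
  with itself. It serves twice: with indicator vectors of cliques for mr \<le> cc, and with unit
  vectors, as a diagonal projection, for M \<le> Z.\<close>

definition gram_sum :: "nat \<Rightarrow> ('b \<Rightarrow> nat \<Rightarrow> real) \<Rightarrow> 'b set \<Rightarrow> real mat" where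
  "gram_sum n f F = mat n n (\<lambda>(i, j). \<Sum>C\<in>F. f C i * f C j)"

lemma gram_sum_carrier [simp]: "gram_sum n f F \<in> carrier_mat n n"
  by (simp add: gram_sum_def)

lemma dim_row_gram_sum [simp]: "dim_row (gram_sum n f F) = n"
  by (simp add: gram_sum_def)

text \<open>Each summand is an outer product, hence of rank at most 1, and rank is
  subadditive.\<close>

lemma mat_rank_gram_sum_le:
  assumes "finite F"
  shows "mat_rank (gram_sum n f F) \<le> card F"
  using assms
proof (induction F)
  case empty
  have "gram_sum n f {} = 0\<^sub>m n n"
    by (intro eq_matI) (auto simp: gram_sum_def)
  then show ?case
    using vec_space.rank_0I[of n n] by (simp add: mat_rank_def)
next
  case (insert C F)
  have "gram_sum n f (insert C F) = gram_sum n f {C} + gram_sum n f F"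
    by (intro eq_matI) (auto simp: gram_sum_def insert.hyps)
  moreover have "mat_rank (gram_sum n f {C}) \<le> 1"
    using vec_space.rank_le_1_product_entries[of "gram_sum n f {C}" n n "f C" "f C"]
    by (simp add: mat_rank_def gram_sum_def)
  ultimately show ?case
    using insert mat_rank_add_le[of "gram_sum n f {C}" n n "gram_sum n f F"] by simp
qed

text \<open>The quadratic form is a sum of squares of linear forms. It is therefore nonnegative, and
  for finite \<open>F\<close> it vanishes only if every one of these forms does.\<close>

lemma scalar_prod_gram_sum:
  fixes v :: "real vec"
  assumes v: "v \<in> carrier_vec n"
  shows "v \<bullet> (gram_sum n f F *\<^sub>v v) = (\<Sum>C\<in>F. (\<Sum>i<n. f C i * v $ i)\<^sup>2)"
proof -
  have "v \<bullet> (gram_sum n f F *\<^sub>v v)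
      = (\<Sum>i<n. v $ i * (\<Sum>j<n. (\<Sum>C\<in>F. f C i * f C j) * v $ j))"
    using v by (simp add: scalar_prod_def gram_sum_def atLeast0LessThan)
  also have "\<dots> = (\<Sum>i<n. \<Sum>j<n. \<Sum>C\<in>F. (f C i * v $ i) * (f C j * v $ j))"
    by (simp add: sum_distrib_left sum_distrib_right mult_ac)
  also have "\<dots> = (\<Sum>i<n. \<Sum>C\<in>F. \<Sum>j<n. (f C i * v $ i) * (f C j * v $ j))"
    by (intro sum.cong refl sum.swap)
  also have "\<dots> = (\<Sum>C\<in>F. \<Sum>i<n. \<Sum>j<n. (f C i * v $ i) * (f C j * v $ j))"
    by (rule sum.swap)
  also have "\<dots> = (\<Sum>C\<in>F. (\<Sum>i<n. f C i * v $ i)\<^sup>2)"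
    by (simp add: power2_eq_square sum_product)
  finally show ?thesis .
qed

text \<open>
  If \<open>E\<close> is the diagonal projection onto the coordinates in \<open>S\<close>, then \<open>v\<^sup>T (A\<^sup>2 + E) v\<close> is the sum
  of the squares of the entries of \<open>A v\<close> and of those entries of \<open>v\<close> indexed by \<open>S\<close>. So \<open>A\<^sup>2 + E\<close>
  is nonsingular, and \<open>n \<le> rank A + |S|\<close>.
\<close>

lemma kernel_dim_le_card:
  fixes A :: "real mat"
  assumes A: "A \<in> carrier_mat n n" and sym: "A\<^sup>T = A" and fin: "finite S" and S: "S \<subseteq> {..<n}"
    and ker: "\<And>v. v \<in> carrier_vec n \<Longrightarrow> A *\<^sub>v v = 0\<^sub>v n \<Longrightarrow> \<forall>i\<in>S. v $ i = 0 \<Longrightarrow> v = 0\<^sub>v n"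
  shows "kernel_dim A \<le> card S"
proof -
  \<comment> \<open>The vectors indexed by \<open>b\<close> in \<open>S\<close> are the unit
    vectors, so this sum is the diagonal projection onto the coordinates in \<open>S\<close>. The
    fact \<open>sel\<close> below says that the linear form of index \<open>b\<close> reads off
    coordinate \<open>b\<close>.\<close>
  let ?E = "gram_sum n (\<lambda>b i. of_bool (i = b)) S"
  let ?M = "A * A + ?E"
  have M: "?M \<in> carrier_mat n n"
    using A by simp
  have "v = 0\<^sub>v n" if v: "v \<in> carrier_vec n" and Mv: "?M *\<^sub>v v = 0\<^sub>v n" for v
  proof -
    have Av: "A *\<^sub>v v \<in> carrier_vec n"
      using A v by simp
    have sel: "(\<Sum>i<n. of_bool (i = b) * v $ i) = v $ b" if "b \<in> S" for b
    proof -
      have "(\<Sum>i<n. of_bool (i = b) * v $ i) = (\<Sum>i<n. if i = b then v $ i else 0)"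
        by (intro sum.cong) auto
      also have "\<dots> = v $ b"
        using that S by auto
      finally show ?thesis .
    qed
    have "0 = v \<bullet> (?M *\<^sub>v v)"
      using v by (simp add: Mv)
    also have "?M *\<^sub>v v = A *\<^sub>v (A *\<^sub>v v) + ?E *\<^sub>v v"
      using A v by (simp add: add_mult_distrib_mat_vec[of _ n n])
    also have "v \<bullet> \<dots> = v \<bullet> (A *\<^sub>v (A *\<^sub>v v)) + v \<bullet> (?E *\<^sub>v v)"
      using A v by (intro scalar_prod_add_distrib[of _ n] mult_mat_vec_carrier[of _ n n]) auto
    \<comment> \<open>Symmetry of \<open>A\<close> moves one factor to the other side, turning the
      term into the squared norm of \<open>A v\<close>.\<close>
    also have "v \<bullet> (A *\<^sub>v (A *\<^sub>v v)) = (A *\<^sub>v v) \<bullet> (A *\<^sub>v v)"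
      using transpose_vec_mult_scalar[OF A Av v] sym by simp
    also have "v \<bullet> (?E *\<^sub>v v) = (\<Sum>b\<in>S. (v $ b)\<^sup>2)"
      unfolding scalar_prod_gram_sum[OF v] by (intro sum.cong refl) (simp only: sel)
    finally have "(A *\<^sub>v v) \<bullet> (A *\<^sub>v v) + (\<Sum>b\<in>S. (v $ b)\<^sup>2) = 0"
      by simp
    moreover have "0 \<le> (A *\<^sub>v v) \<bullet> (A *\<^sub>v v)"
      by (simp add: scalar_prod_def sum_nonneg)
    moreover have "0 \<le> (\<Sum>b\<in>S. (v $ b)\<^sup>2)"
      by (simp add: sum_nonneg)
    ultimately have "(A *\<^sub>v v) \<bullet> (A *\<^sub>v v) = 0" and "(\<Sum>b\<in>S. (v $ b)\<^sup>2) = 0"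
      by linarith+
    then have "A *\<^sub>v v = 0\<^sub>v n" and "\<forall>b\<in>S. v $ b = 0"
      using conjugate_square_eq_0_vec[OF Av] fin by (simp_all add: sum_nonneg_eq_0_iff)
    then show ?thesis
      using ker v by blast
  qed
  then have "det ?M \<noteq> 0"
    using det_0_iff_vec_prod_zero_field[OF M] by auto
  then have "n = mat_rank ?M"
    using vec_space.low_rank_det_zero[OF M] A by (simp add: mat_rank_def)
  also have "\<dots> \<le> mat_rank (A * A) + mat_rank ?E"
    using A by (intro mat_rank_add_le[of _ n n]) auto
  also have "\<dots> \<le> mat_rank A + card S"
    using mat_rank_mult_le[OF A A] mat_rank_gram_sum_le[OF fin] by (intro add_mono)
  finally show ?thesis
    using rank_plus_kernel_dim[of A] A by simp
qed


section \<open>Matrices of a graph, minimum rank and maximum nullity\<close>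

lemma matrices_of_carrier:
  assumes "A \<in> matrices_of G"
  shows "A \<in> carrier_mat (card (pverts G)) (card (pverts G))"
proof -
  obtain vs where "distinct vs" "set vs = pverts G" "describes G vs A"
    using assms unfolding matrices_of_def by blast
  then show ?thesis
    using distinct_card[of vs] by (simp add: describes_def)
qed

lemma matrices_of_nonempty:
  assumes "pair_graph G"
  shows "matrices_of G \<noteq> {}"
proof -
  interpret pair_graph G by fact
  obtain vs where vs: "distinct vs" "set vs = pverts G"
    using finite_distinct_list[OF pair_finite_verts] by blast
  \<comment> \<open>The adjacency matrix is a witness; it guarantees that the \<open>Min\<close> and
    \<open>Max\<close> in the definitions range over nonempty sets.\<close>
  let ?A = "mat (length vs) (length vs) (\<lambda>(i, j). of_bool ((vs ! i, vs ! j) \<in> parcs G)) :: real mat"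
  have "describes G vs ?A"
    unfolding describes_def by (auto intro!: eq_matI dest: arcs_symmetric)
  then show ?thesis
    using vs unfolding matrices_of_def by blast
qed

text \<open>The diagonal is unrestricted, so \<open>matrices_of G\<close> itself is infinite unless
  the graph has no vertices. \<open>Min\<close> and \<open>Max\<close> are meaningful because ranks
  and nullities are natural numbers bounded by the number of vertices.\<close>

lemma finite_image_matrices_of:
  assumes "\<And>A. A \<in> carrier_mat (card (pverts G)) (card (pverts G)) \<Longrightarrow> f A \<le> card (pverts G)"
  shows "finite (f ` matrices_of G)"
proof (rule finite_subset)
  show "f ` matrices_of G \<subseteq> {..card (pverts G)}"
    using assms[OF matrices_of_carrier] by auto
qed simp

lemma rank_plus_kernel_dim_matrices_of:
  assumes "A \<in> matrices_of G"
  shows "mat_rank A + kernel_dim A = card (pverts G)"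
  using rank_plus_kernel_dim[of A] matrices_of_carrier[OF assms] by simp

lemma finite_ranks: "finite (mat_rank ` matrices_of G)"
proof (rule finite_image_matrices_of)
  show "mat_rank A \<le> card (pverts G)" if "A \<in> carrier_mat (card (pverts G)) (card (pverts G))" for A :: "real mat"
    using rank_plus_kernel_dim[of A] that by simp
qed

lemma finite_nullities: "finite (kernel_dim ` matrices_of G)"
proof (rule finite_image_matrices_of)
  show "kernel_dim A \<le> card (pverts G)" if "A \<in> carrier_mat (card (pverts G)) (card (pverts G))" for A :: "real mat"
    using rank_plus_kernel_dim[of A] that by simp
qed

text \<open>Rank and nullity of each single matrix add up to the number of vertices. One inequality
  starts from a matrix of least rank, the other from a matrix of greatest nullity.\<close>

lemma min_rank_plus_max_nullity:
  assumes "pair_graph G"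
  shows "min_rank G + max_nullity G = card (pverts G)"
proof (rule antisym)
  have ne: "matrices_of G \<noteq> {}"
    by (rule matrices_of_nonempty) fact
  obtain A where A: "A \<in> matrices_of G" and "min_rank G = mat_rank A"
    using Min_in[OF finite_ranks, of G] ne unfolding min_rank_def by blast
  moreover have "kernel_dim A \<le> max_nullity G"
    unfolding max_nullity_def using A by (intro Max_ge finite_nullities) simp
  ultimately show "card (pverts G) \<le> min_rank G + max_nullity G"
    using rank_plus_kernel_dim_matrices_of[OF A] by simp
  obtain B where B: "B \<in> matrices_of G" and "max_nullity G = kernel_dim B"
    using Max_in[OF finite_nullities, of G] ne unfolding max_nullity_def by blast
  moreover have "min_rank G \<le> mat_rank B"
    unfolding min_rank_def using B by (intro Min_le finite_ranks) simp
  ultimately show "min_rank G + max_nullity G \<le> card (pverts G)"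
    using rank_plus_kernel_dim_matrices_of[OF B] by simp
qed

section \<open>Clique covers and the bound mr \<le> cc\<close>

lemma finite_clique_covers:
  assumes "pair_graph G"
  shows "finite {\<C>. clique_cover G \<C>}"
proof -
  interpret pair_graph G by fact
  have "{\<C>. clique_cover G \<C>} \<subseteq> Pow (Pow (pverts G))"
    by (auto simp: clique_cover_def clique_def)
  then show ?thesis
    using finite_subset pair_finite_verts by blast
qed

lemma finite_clique_cover:
  assumes "pair_graph G" and "clique_cover G \<C>"
  shows "finite \<C>"
proof -
  interpret pair_graph G by fact
  have "\<C> \<subseteq> Pow (pverts G)"
    using assms(2) by (auto simp: clique_cover_def clique_def)
  then show ?thesis
    using finite_subset pair_finite_verts by blast
qed

lemma clique_cover_number_le:
  assumes "pair_graph G" and "clique_cover G \<C>"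
  shows "clique_cover_number G \<le> card \<C>"
  unfolding clique_cover_number_def
  using assms finite_clique_covers by (intro Min_le) auto

lemma clique_cover_number_attained:
  assumes "pair_graph G"
  obtains \<C> where "clique_cover G \<C>" and "card \<C> = clique_cover_number G"
proof -
  interpret pair_graph G by fact
  \<comment> \<open>The edges themselves, as two-element cliques, form a cover, so the minimum is
    taken over a nonempty set.\<close>
  have "clique_cover G ((\<lambda>(u, v). {u, v}) ` parcs G)"
    unfolding clique_cover_def clique_def
    using arcs_symmetric by (auto dest: in_arcsD1 in_arcsD2)
  then have "clique_cover_number G \<in> card ` {\<C>. clique_cover G \<C>}"
    unfolding clique_cover_number_def using finite_clique_covers[OF assms]
    by (intro Min_in) auto
  with that show thesis
    by auto
qed

text \<open>In the sum of the 0/1 matrices of the cliques, an off-diagonal entry counts the cliques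
  containing both vertices. Nothing cancels, so the entry is nonzero exactly when some clique
  contains both, that is, when they are adjacent.\<close>

lemma min_rank_le_clique_cover_number:
  assumes G: "pair_graph G"
  shows "min_rank G \<le> clique_cover_number G"
proof -
  interpret pair_graph G by (rule G)
  obtain \<C> where cc: "clique_cover G \<C>" and card: "card \<C> = clique_cover_number G"
    using clique_cover_number_attained[OF G] .
  have fin: "finite \<C>"
    using finite_clique_cover[OF G cc] .
  obtain vs where vs: "distinct vs" "set vs = pverts G"
    using finite_distinct_list[OF pair_finite_verts] by blast
  define A where "A = gram_sum (length vs) (\<lambda>C i. of_bool (vs ! i \<in> C)) \<C>"
  have arc_iff: "(u, v) \<in> parcs G \<longleftrightarrow> (\<exists>C\<in>\<C>. u \<in> C \<and> v \<in> C)" if "u \<noteq> v" for u v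
  proof
    assume "(u, v) \<in> parcs G"
    then show "\<exists>C\<in>\<C>. u \<in> C \<and> v \<in> C"
      using cc unfolding clique_cover_def by auto
  next
    assume "\<exists>C\<in>\<C>. u \<in> C \<and> v \<in> C"
    then obtain C where C: "C \<in> \<C>" "u \<in> C" "v \<in> C"
      by blast
    then have "clique G C"
      using cc unfolding clique_cover_def by simp
    then show "(u, v) \<in> parcs G"
      using C that unfolding clique_def by simp
  qed
  have entry: "A $$ (i, j) \<noteq> 0 \<longleftrightarrow> (vs ! i, vs ! j) \<in> parcs G"
    if ij: "i < length vs" "j < length vs" "i \<noteq> j" for i j
  proof -
    have "vs ! i \<noteq> vs ! j"
      using vs ij by (simp add: nth_eq_iff_index_eq)
    then have "(\<exists>C\<in>\<C>. vs ! i \<in> C \<and> vs ! j \<in> C) \<longleftrightarrow> (vs ! i, vs ! j) \<in> parcs G"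
      by (rule arc_iff[symmetric])
    then show ?thesis
      using ij fin by (auto simp: A_def gram_sum_def sum_nonneg_eq_0_iff)
  qed
  have "describes G vs A"
    unfolding describes_def
    using entry by (auto simp: A_def gram_sum_def mult.commute intro!: eq_matI)
  then have "A \<in> matrices_of G"
    using vs unfolding matrices_of_def by blast
  then have "min_rank G \<le> mat_rank A"
    unfolding min_rank_def by (intro Min_le finite_ranks) simp
  also have "\<dots> \<le> card \<C>"
    unfolding A_def by (rule mat_rank_gram_sum_le[OF fin])
  finally show ?thesis
    by (simp add: card)
qed

section \<open>Zero forcing and the bound M \<le> Z\<close>

text \<open>
  Unlike \<open>colour_change\<close>, the closure below does not depend on the order of the forces, and forces
  in a subgraph transfer to the whole graph.
\<close>

inductive_set forced :: "'a pair_pre_digraph \<Rightarrow> 'a set \<Rightarrow> 'a set" for G B where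
  base: "v \<in> B \<Longrightarrow> v \<in> forced G B"
| step: "u \<in> forced G B \<Longrightarrow> (u, v) \<in> parcs G \<Longrightarrow>
    (\<And>w. (u, w) \<in> parcs G \<Longrightarrow> w \<noteq> v \<Longrightarrow> w \<in> forced G B) \<Longrightarrow> v \<in> forced G B"

text \<open>Sets reached by colour changes stay inside the closure. Conversely, a reachable set of
  greatest cardinality admits no further force, so it contains the closure and hence all
  vertices.\<close>

lemma zero_forcing_set_iff_forced:
  assumes "pair_graph G"
  shows "zero_forcing_set G B \<longleftrightarrow> B \<subseteq> pverts G \<and> pverts G \<subseteq> forced G B"
proof -
  interpret pair_graph G by fact
  have "C \<subseteq> forced G B" if "(colour_change G)\<^sup>*\<^sup>* B C" for C
    using that
  proof induction
    case base
    then show ?case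
      by (auto intro: forced.base)
  next
    case (step C D)
    then obtain u v where u: "u \<in> C" and uv: "{w. (u, w) \<in> parcs G \<and> w \<notin> C} = {v}"
      and D: "D = insert v C"
      unfolding colour_change_def by auto
    have "v \<in> forced G B"
    proof (rule forced.step)
      show "u \<in> forced G B"
        using u step.IH by (rule subsetD[rotated])
      show "(u, v) \<in> parcs G"
        using uv by auto
      show "w \<in> forced G B" if "(u, w) \<in> parcs G" "w \<noteq> v" for w
        using that uv step.IH by auto
    qed
    then show ?case
      using D step.IH by simp
  qed
  moreover have "(colour_change G)\<^sup>*\<^sup>* B (pverts G)"
    if sub: "B \<subseteq> pverts G" and all: "pverts G \<subseteq> forced G B"
  proof -
    have range: "C \<subseteq> pverts G" if "(colour_change G)\<^sup>*\<^sup>* B C" for C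
      using that
      by induction (use sub in \<open>auto simp: colour_change_def dest: in_arcsD2\<close>)
    \<comment> \<open>Only subsets of the finite vertex set are reachable, so the cardinalities are
      bounded and a largest reachable set exists.\<close>
    have "\<exists>C. (colour_change G)\<^sup>*\<^sup>* B C \<and> (\<forall>D. (colour_change G)\<^sup>*\<^sup>* B D \<longrightarrow> card D \<le> card C)"
    proof (rule ex_has_greatest_nat)
      show "(colour_change G)\<^sup>*\<^sup>* B B"
        by simp
      show "\<forall>D. (colour_change G)\<^sup>*\<^sup>* B D \<longrightarrow> card D < Suc (card (pverts G))"
        using card_mono[OF pair_finite_verts range] by (simp add: less_Suc_eq_le)
    qed
    then obtain C where C: "(colour_change G)\<^sup>*\<^sup>* B C"
      and max: "\<And>D. (colour_change G)\<^sup>*\<^sup>* B D \<Longrightarrow> card D \<le> card C"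
      by blast
    have BC: "B \<subseteq> C"
      using C by induction (auto simp: colour_change_def)
    have "finite C"
      using range[OF C] finite_subset pair_finite_verts by blast
    have "v \<in> C" if "v \<in> forced G B" for v
      using that
    proof induction
      case (base v)
      then show ?case
        using BC by blast
    next
      case (step u v)
      show ?case
      proof (rule ccontr)
        assume "v \<notin> C"
        \<comment> \<open>By the induction hypotheses \<open>u\<close> and all its neighbours other
          than \<open>v\<close> lie in \<open>C\<close>, so \<open>v\<close> would be the only white
          neighbour of \<open>u\<close>.\<close>
        with step have "colour_change G C (insert v C)"
          unfolding colour_change_def by (intro bexI[of _ u]) auto
        then have "card (insert v C) \<le> card C"
          using C by (intro max) simp
        then show False
          using \<open>v \<notin> C\<close> \<open>finite C\<close> by simp
      qed
    qed
    then have "C = pverts G"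
      using all range[OF C] by blast
    then show ?thesis
      using C by simp
  qed
  ultimately show ?thesis
    unfolding zero_forcing_set_def by blast
qed

lemma finite_zero_forcing_sets:
  assumes "pair_graph G"
  shows "finite {B. zero_forcing_set G B}"
proof -
  interpret pair_graph G by fact
  have "{B. zero_forcing_set G B} \<subseteq> Pow (pverts G)"
    by (auto simp: zero_forcing_set_def)
  then show ?thesis
    using finite_subset pair_finite_verts by blast
qed

lemma zero_forcing_number_le:
  assumes "pair_graph G" and "zero_forcing_set G B"
  shows "zero_forcing_number G \<le> card B"
  unfolding zero_forcing_number_def
  using assms finite_zero_forcing_sets by (intro Min_le) auto

lemma zero_forcing_number_attained:
  assumes "pair_graph G"
  obtains B where "zero_forcing_set G B" and "card B = zero_forcing_number G"
proof -
  have "zero_forcing_set G (pverts G)"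
    by (simp add: zero_forcing_set_def)
  then have "zero_forcing_number G \<in> card ` {B. zero_forcing_set G B}"
    unfolding zero_forcing_number_def using finite_zero_forcing_sets[OF assms]
    by (intro Min_in) auto
  with that show thesis
    by auto
qed

text \<open>Induction on the forces: when \<open>u\<close> forces \<open>v\<close>, the row of
  \<open>u\<close> in \<open>A x = 0\<close> reduces to the single term of \<open>v\<close>, whose
  coefficient is nonzero because \<open>uv\<close> is an edge.\<close>

lemma kernel_zero_on_forced:
  assumes G: "pair_graph G" and vs: "distinct vs" "set vs = pverts G"
    and A: "describes G vs A" and x: "x \<in> carrier_vec (length vs)"
    and Ax: "A *\<^sub>v x = 0\<^sub>v (length vs)"
    and B: "\<And>i. i < length vs \<Longrightarrow> vs ! i \<in> B \<Longrightarrow> x $ i = 0"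
    and v: "v \<in> forced G B" and i: "i < length vs" "vs ! i = v"
  shows "x $ i = 0"
  using v i
proof (induction arbitrary: i)
  case (base v)
  then show ?case
    using B by blast
next
  case (step u v)
  interpret pair_graph G by (rule G)
  have "u \<in> set vs"
    using step.hyps vs in_arcsD1 by blast
  then obtain k where k: "k < length vs" "vs ! k = u"
    by (auto simp: in_set_conv_nth)
  have "u \<noteq> v"
    using step.hyps(2) pair_no_loops by force
  then have ki: "k \<noteq> i"
    using k step.prems by auto
  have A': "A \<in> carrier_mat (length vs) (length vs)"
    and nz: "A $$ (k, j) \<noteq> 0 \<longleftrightarrow> (u, vs ! j) \<in> parcs G" if "j < length vs" "j \<noteq> k" for j
    using A k that unfolding describes_def by auto
  \<comment> \<open>The diagonal entry may be nonzero, but there \<open>x\<close> vanishes because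
    \<open>u\<close> is forced. Elsewhere the entry is zero for a non-neighbour of \<open>u\<close>,
    and \<open>x\<close> is zero at a neighbour other than \<open>v\<close>.\<close>
  have zero: "A $$ (k, j) * x $ j = 0" if j: "j < length vs" "j \<noteq> i" for j
  proof (cases "j = k")
    case True
    then show ?thesis
      using step.IH(1) k by simp
  next
    case False
    have "vs ! j \<noteq> v"
      using j step.prems vs by (auto simp: nth_eq_iff_index_eq)
    then show ?thesis
      using nz[OF j(1) False] step.IH(2)[of "vs ! j" j] j by auto
  qed
  have "0 = (A *\<^sub>v x) $ k"
    using k by (simp add: Ax)
  also have "\<dots> = (\<Sum>j<length vs. A $$ (k, j) * x $ j)"
    using A'[OF step.prems(1) ki[symmetric]] x k by (simp add: scalar_prod_def atLeast0LessThan)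
  also have "\<dots> = (\<Sum>j\<in>{i}. A $$ (k, j) * x $ j)"
    using zero step.prems by (intro sum.mono_neutral_right) auto
  finally show ?case
    using nz[OF step.prems(1) ki[symmetric]] step by simp
qed

lemma max_nullity_le_zero_forcing_number:
  assumes G: "pair_graph G"
  shows "max_nullity G \<le> zero_forcing_number G"
proof -
  obtain B where B: "zero_forcing_set G B" and card: "card B = zero_forcing_number G"
    using zero_forcing_number_attained[OF G] .
  then have BV: "B \<subseteq> pverts G" and all: "pverts G \<subseteq> forced G B"
    using zero_forcing_set_iff_forced[OF G] by auto
  have "kernel_dim A \<le> card B" if mem: "A \<in> matrices_of G" for A
  proof -
    obtain vs where vs: "distinct vs" "set vs = pverts G" and A: "describes G vs A"
      using mem unfolding matrices_of_def by blast
    let ?n = "length vs"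
    \<comment> \<open>The positions of the vertices of \<open>B\<close> in the enumeration of this
      matrix; \<open>vs\<close> maps them bijectively onto \<open>B\<close>, so the bound
      \<open>card B\<close> is the same for all matrices.\<close>
    let ?S = "{i. i < ?n \<and> vs ! i \<in> B}"
    have "kernel_dim A \<le> card ?S"
    proof (rule kernel_dim_le_card)
      fix x :: "real vec"
      assume x: "x \<in> carrier_vec ?n" "A *\<^sub>v x = 0\<^sub>v ?n" and zero: "\<forall>i\<in>?S. x $ i = 0"
      have "x $ i = 0" if "i < ?n" for i
      proof (rule kernel_zero_on_forced[OF G vs A x])
        show "x $ j = 0" if "j < ?n" "vs ! j \<in> B" for j
          using zero that by simp
        show "vs ! i \<in> forced G B"
          using all vs nth_mem[OF that] by auto
      qed (use that in simp_all)
      then show "x = 0\<^sub>v ?n"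
        using x by (intro eq_vecI) auto
    qed (use A in \<open>auto simp: describes_def\<close>)
    also have "card ?S = card ((!) vs ` ?S)"
      using vs by (intro card_image[symmetric]) (auto simp: inj_on_def nth_eq_iff_index_eq)
    also have "(!) vs ` ?S = B"
    proof
      show "B \<subseteq> (!) vs ` ?S"
      proof
        fix b assume b: "b \<in> B"
        then have "b \<in> set vs"
          using BV vs by auto
        then show "b \<in> (!) vs ` ?S"
          using b by (auto simp: in_set_conv_nth)
      qed
    qed auto
    finally show ?thesis .
  qed
  then have "max_nullity G \<le> card B"
    unfolding max_nullity_def
    using matrices_of_nonempty[OF G] by (intro Max.boundedI finite_nullities) auto
  then show ?thesis
    by (simp add: card)
qed

section \<open>Bounds for zero forcing and clique covers of the generalized corona\<close>

context
  fixes G :: "'a pair_pre_digraph" and H :: "'a \<Rightarrow> 'b pair_pre_digraph"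
  assumes G: "pair_graph G" and H: "\<And>v. v \<in> pverts G \<Longrightarrow> pair_graph (H v)"
begin

interpretation G: pair_graph G by (rule G)

lemma pair_graph_corona: "pair_graph (gen_corona G H)"
  by (rule pair_graph_gen_corona[OF G H])

lemma finite_pverts_corona_part:
  assumes "v \<in> pverts G"
  shows "finite (pverts (H v))"
proof -
  interpret pair_graph "H v" by (rule H[OF assms])
  show ?thesis by (rule pair_finite_verts)
qed

lemma card_pverts_gen_corona:
  "card (pverts (gen_corona G H)) = card (pverts G) + (\<Sum>v\<in>pverts G. card (pverts (H v)))"
proof -
  have "pverts (gen_corona G H) = pverts G <+> (SIGMA v:pverts G. pverts (H v))"
    by (auto simp: gen_corona_def)
  then show ?thesis
    using G.pair_finite_verts finite_pverts_corona_part by (simp add: card_Plus)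
qed

lemma zero_forcing_number_gen_corona_le:
  "zero_forcing_number (gen_corona G H)
    \<le> zero_forcing_number G + (\<Sum>v\<in>pverts G. zero_forcing_number (H v))"
proof -
  let ?K = "gen_corona G H"
  obtain B where B: "zero_forcing_set G B" "card B = zero_forcing_number G"
    using zero_forcing_number_attained[OF G] .
  have "\<exists>C. zero_forcing_set (H v) C \<and> card C = zero_forcing_number (H v)"
    if "v \<in> pverts G" for v
    using zero_forcing_number_attained[OF H[OF that]] by blast
  then obtain C where C: "\<And>v. v \<in> pverts G \<Longrightarrow> zero_forcing_set (H v) (C v)"
    and cardC: "\<And>v. v \<in> pverts G \<Longrightarrow> card (C v) = zero_forcing_number (H v)"
    by metis
  \<comment> \<open>The vertex type of the corona is a sum type, so \<open><+>\<close> places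
    \<open>B\<close> on the copy of \<open>G\<close> and each \<open>C v\<close> on the copy of
    \<open>H v\<close>.\<close>
  let ?D = "B <+> (SIGMA v:pverts G. C v)"
  note BD = B(1)[unfolded zero_forcing_set_iff_forced[OF G]]
  have CD: "C v \<subseteq> pverts (H v)" "pverts (H v) \<subseteq> forced (H v) (C v)" if "v \<in> pverts G" for v
    using C[OF that] zero_forcing_set_iff_forced[OF H[OF that]] by auto
  \<comment> \<open>In the corona a vertex of \<open>H v\<close> gains only the neighbour
    \<open>v\<close>. Blackness of \<open>v\<close> is a premise here so that this fact can be used
    inside the induction for \<open>spine\<close>, where only the forcing vertex is known to be
    black.\<close>
  have part: "Inr (v, x) \<in> forced ?K ?D"
    if v: "v \<in> pverts G" and black: "Inl v \<in> forced ?K ?D" and x: "x \<in> forced (H v) (C v)" for v x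
    using x
  proof induction
    case (base x)
    then show ?case
      using v by (intro forced.base) auto
  next
    case (step x y)
    show ?case
      by (rule forced.step[OF step.IH(1)])
        (use v black step in \<open>auto simp: gen_corona_def\<close>)
  qed
  have spine: "Inl v \<in> forced ?K ?D" if "v \<in> forced G B" for v
    using that
  proof induction
    case (base v)
    then show ?case
      by (intro forced.base) auto
  next
    case (step u v)
    have u: "u \<in> pverts G"
      using step.hyps(2) by (rule G.in_arcsD1)
    \<comment> \<open>Before \<open>u\<close> may force \<open>v\<close> in the corona, its
      additional neighbours, which are all the vertices of \<open>H u\<close>, must be
      black.\<close>
    have part_u: "Inr (u, x) \<in> forced ?K ?D" if "x \<in> pverts (H u)" for x
      using part[OF u step.IH(1)] CD(2)[OF u] that by blast
    show ?case
    proof (rule forced.step[OF step.IH(1)])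
      show "(Inl u, Inl v) \<in> parcs ?K"
        using step.hyps(2) by (simp add: gen_corona_def)
      fix w assume "(Inl u, w) \<in> parcs ?K" and "w \<noteq> Inl v"
      then consider w' where "w = Inl w'" "(u, w') \<in> parcs G" "w' \<noteq> v"
        | x where "w = Inr (u, x)" "x \<in> pverts (H u)"
        by (auto simp: gen_corona_def)
      then show "w \<in> forced ?K ?D"
        using step.IH(2) part_u by cases auto
    qed
  qed
  have "?D \<subseteq> pverts ?K"
    using BD CD(1) by (auto simp: gen_corona_def)
  moreover have "pverts ?K \<subseteq> forced ?K ?D"
    using spine part BD CD(2) by (auto simp: gen_corona_def subset_iff)
  ultimately have "zero_forcing_set ?K ?D"
    using zero_forcing_set_iff_forced[OF pair_graph_corona] by blast
  then have "zero_forcing_number ?K \<le> card ?D"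
    by (rule zero_forcing_number_le[OF pair_graph_corona])
  also have "card ?D = card B + (\<Sum>v\<in>pverts G. card (C v))"
  proof -
    have "finite B" and "\<forall>v\<in>pverts G. finite (C v)"
      using finite_subset[OF _ G.pair_finite_verts] finite_subset[OF CD(1) finite_pverts_corona_part] BD
      by auto
    then show ?thesis
      using G.pair_finite_verts by (simp add: card_Plus)
  qed
  also have "\<dots> = zero_forcing_number G + (\<Sum>v\<in>pverts G. zero_forcing_number (H v))"
    by (simp add: B(2) cardC)
  finally show ?thesis .
qed

lemma clique_cover_number_gen_corona_le:
  assumes no_isolated: "\<And>v x. v \<in> pverts G \<Longrightarrow> x \<in> pverts (H v) \<Longrightarrow> \<exists>y. (x, y) \<in> parcs (H v)"
  shows "clique_cover_number (gen_corona G H)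
    \<le> clique_cover_number G + (\<Sum>v\<in>pverts G. clique_cover_number (H v))"
proof -
  let ?K = "gen_corona G H"
  obtain \<B> where B: "clique_cover G \<B>" "card \<B> = clique_cover_number G"
    using clique_cover_number_attained[OF G] .
  have "\<exists>\<C>. clique_cover (H v) \<C> \<and> card \<C> = clique_cover_number (H v)"
    if "v \<in> pverts G" for v
    using clique_cover_number_attained[OF H[OF that]] by blast
  then obtain \<C> where C: "\<And>v. v \<in> pverts G \<Longrightarrow> clique_cover (H v) (\<C> v)"
    and cardC: "\<And>v. v \<in> pverts G \<Longrightarrow> card (\<C> v) = clique_cover_number (H v)"
    by metis
  \<comment> \<open>Each clique of \<open>H v\<close> is enlarged by \<open>v\<close>, which is
    adjacent to all of \<open>H v\<close>. The number of cliques does not grow, so the edges between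
    \<open>v\<close> and \<open>H v\<close> cost nothing extra.\<close>
  let ?part = "\<lambda>v. (\<lambda>C. insert (Inl v) ((\<lambda>x. Inr (v, x)) ` C)) ` \<C> v"
  let ?\<D> = "(`) Inl ` \<B> \<union> (\<Union>v\<in>pverts G. ?part v)"
  have cover: "\<exists>C\<in>\<C> v. x \<in> C \<and> y \<in> C" if "v \<in> pverts G" "(x, y) \<in> parcs (H v)" for v x y
    using C[OF that(1)] that(2) by (auto simp: clique_cover_def)
  have "clique ?K D" if "D \<in> ?\<D>" for D
    using that
  proof
    assume "D \<in> (`) Inl ` \<B>"
    then show ?thesis
      using B(1) by (fastforce simp: clique_cover_def clique_def gen_corona_def)
  next
    assume "D \<in> (\<Union>v\<in>pverts G. ?part v)"
    then obtain v C' where v: "v \<in> pverts G" and "C' \<in> \<C> v"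
      and D: "D = insert (Inl v) ((\<lambda>x. Inr (v, x)) ` C')"
      by auto
    then have "clique (H v) C'"
      using C[OF v] by (simp add: clique_cover_def)
    then show ?thesis
      using v unfolding D by (auto simp: clique_def gen_corona_def)
  qed
  moreover have "\<exists>D\<in>?\<D>. a \<in> D \<and> b \<in> D" if "(a, b) \<in> parcs ?K" for a b
  proof -
    \<comment> \<open>Edges within \<open>H v\<close> and edges from \<open>v\<close> to
      \<open>H v\<close> are treated alike: each lies in a triangle on \<open>v\<close>,
      \<open>x\<close>, \<open>y\<close> with \<open>xy\<close> an edge of \<open>H v\<close>, and
      the enlarged clique covering \<open>xy\<close> contains the whole triangle.\<close>
    consider
        u v where "a = Inl u" "b = Inl v" "(u, v) \<in> parcs G"
      | v x y where "v \<in> pverts G" "(x, y) \<in> parcs (H v)"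
          "a \<in> {Inl v, Inr (v, x)}" "b \<in> {Inl v, Inr (v, x), Inr (v, y)}"
    proof -
      consider
          u v where "a = Inl u" "b = Inl v" "(u, v) \<in> parcs G"
        | v x y where "v \<in> pverts G" "(x, y) \<in> parcs (H v)" "a = Inr (v, x)" "b = Inr (v, y)"
        | v x where "v \<in> pverts G" "x \<in> pverts (H v)"
            "a = Inl v \<and> b = Inr (v, x) \<or> a = Inr (v, x) \<and> b = Inl v"
        using \<open>(a, b) \<in> parcs ?K\<close> by (auto simp: gen_corona_def)
      then show thesis
      proof cases
        case 1
        then show thesis by (rule that(1))
      next
        case 2
        then show thesis by (intro that(2)[of v x y]) auto
      next
        case 3
        \<comment> \<open>For an edge between \<open>v\<close> and \<open>x\<close>, a neighbour
          \<open>y\<close> of \<open>x\<close> in \<open>H v\<close> provides the triangle; it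
          ensures that some clique of the cover of \<open>H v\<close> contains
          \<open>x\<close>.\<close>
        then obtain y where "(x, y) \<in> parcs (H v)"
          using no_isolated by blast
        with 3 show thesis by (intro that(2)[of v x y]) auto
      qed
    qed
    then show ?thesis
    proof cases
      case 1
      then obtain C' where "C' \<in> \<B>" "u \<in> C'" "v \<in> C'"
        using B(1) by (auto simp: clique_cover_def)
      then show ?thesis
        using 1 by (intro bexI[of _ "Inl ` C'"]) auto
    next
      case 2
      then obtain C' where "C' \<in> \<C> v" "x \<in> C'" "y \<in> C'"
        using cover by blast
      then show ?thesis
        using 2 by (intro bexI[of _ "insert (Inl v) ((\<lambda>x. Inr (v, x)) ` C')"]) auto
    qed
  qed
  ultimately have "clique_cover ?K ?\<D>"
    unfolding clique_cover_def by (intro conjI ballI) auto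
  then have "clique_cover_number ?K \<le> card ?\<D>"
    by (rule clique_cover_number_le[OF pair_graph_corona])
  also have "\<dots> \<le> card ((`) (Inl :: 'a \<Rightarrow> 'a + 'a \<times> 'b) ` \<B>) + card (\<Union>v\<in>pverts G. ?part v)"
    by (rule card_Un_le)
  also have "\<dots> \<le> card \<B> + (\<Sum>v\<in>pverts G. card (\<C> v))"
  proof (rule add_mono)
    show "card ((`) (Inl :: 'a \<Rightarrow> 'a + 'a \<times> 'b) ` \<B>) \<le> card \<B>"
      using finite_clique_cover[OF G B(1)] by (rule card_image_le)
    have "card (\<Union>v\<in>pverts G. ?part v) \<le> (\<Sum>v\<in>pverts G. card (?part v))"
      by (rule card_UN_le[OF G.pair_finite_verts])
    also have "\<dots> \<le> (\<Sum>v\<in>pverts G. card (\<C> v))"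
      using finite_clique_cover[OF H C] by (intro sum_mono card_image_le)
    finally show "card (\<Union>v\<in>pverts G. ?part v) \<le> (\<Sum>v\<in>pverts G. card (\<C> v))" .
  qed
  also have "\<dots> = clique_cover_number G + (\<Sum>v\<in>pverts G. clique_cover_number (H v))"
    by (simp add: B(2) cardC)
  finally show ?thesis .
qed

end

section \<open>Equality in the corona by counting vertices\<close>

theorem theorem4p22:
  fixes G :: "'a pair_pre_digraph" and H :: "'a \<Rightarrow> 'b pair_pre_digraph"
  assumes "pair_graph G"
    and "zero_forcing_number G = max_nullity G"
    and "min_rank G = clique_cover_number G"
    and "\<And>v. v \<in> pverts G \<Longrightarrow> pair_graph (H v)"
    and "\<And>v. v \<in> pverts G \<Longrightarrow> zero_forcing_number (H v) = max_nullity (H v)"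
    and "\<And>v. v \<in> pverts G \<Longrightarrow> min_rank (H v) = clique_cover_number (H v)"
    and no_isolated_vertices:
      "\<And>v x. v \<in> pverts G \<Longrightarrow> x \<in> pverts (H v) \<Longrightarrow> \<exists>y. (x, y) \<in> parcs (H v)"
  shows "zero_forcing_number (gen_corona G H) = max_nullity (gen_corona G H) \<and>
    min_rank (gen_corona G H) = clique_cover_number (gen_corona G H)"
proof -
  let ?K = "gen_corona G H" and ?V = "pverts G"
  note G = assms(1) and H = assms(4)
  have K: "pair_graph ?K"
    by (rule pair_graph_gen_corona[OF G H])
  have "zero_forcing_number ?K + clique_cover_number ?K
      \<le> (zero_forcing_number G + (\<Sum>v\<in>?V. zero_forcing_number (H v)))
        + (clique_cover_number G + (\<Sum>v\<in>?V. clique_cover_number (H v)))"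
  proof (rule add_mono)
    show "zero_forcing_number ?K \<le> zero_forcing_number G + (\<Sum>v\<in>?V. zero_forcing_number (H v))"
      by (rule zero_forcing_number_gen_corona_le[OF G H])
    show "clique_cover_number ?K \<le> clique_cover_number G + (\<Sum>v\<in>?V. clique_cover_number (H v))"
      by (rule clique_cover_number_gen_corona_le[OF G H no_isolated_vertices])
  qed
  \<comment> \<open>The hypotheses replace each Z by M and each cc by mr, so the terms pair up as mr
    + M, the number of vertices, for every part.\<close>
  also have "\<dots> = (min_rank G + max_nullity G) + (\<Sum>v\<in>?V. min_rank (H v) + max_nullity (H v))"
    using assms(2,3,5,6) by (simp add: sum.distrib)
  also have "\<dots> = card (pverts ?K)"
    using min_rank_plus_max_nullity[OF G] min_rank_plus_max_nullity[OF H]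
    by (simp add: card_pverts_gen_corona[OF G H])
  also have "\<dots> = min_rank ?K + max_nullity ?K"
    by (rule min_rank_plus_max_nullity[OF K, symmetric])
  \<comment> \<open>Now Z + cc \<le> mr + M for the corona, while M \<le> Z and mr \<le> cc, so
    neither inequality can be strict.\<close>
  finally show ?thesis
    using max_nullity_le_zero_forcing_number[OF K] min_rank_le_clique_cover_number[OF K]
    by linarith
qed

end
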